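(* Let $c_1,\ldots,c_N$ be distinct real numbers, $\gamma_1,\ldots,\gamma_N\in\mathbb{R}$, $m\in\{1,\ldots,N\}$, and fix $\varepsilon>0$. Let $\mathcal M_\varepsilon(t)$, $t\in\mathbb{R}$, be the $N\times N$ matrix with entries $$\mathcal M_\varepsilon(t)_{jj}=\gamma_j+(c_j-c_m)t-i\varepsilon\delta_{jm},\qquad \mathcal M_\varepsilon(t)_{jk}=\frac{2i}{c_j-c_k}\quad(j\ne k).$$ For all sufficiently large positive $t$, label the eigenvalues $z_k^{\varepsilon,+}(t)$, $k=1,\ldots,N$, of $\mathcal M_\varepsilon(t)$ by $$z_k^{\varepsilon,+}(t)=(c_k-c_m)t+\gamma_k-i\varepsilon\delta_{km}+O_\varepsilon(t^{-1})\qquad(t\to+\infty).$$ Then, as $t\to+\infty$, $$-\mathrm{Im}\,z_m^{\varepsilon,+}(t)=\varepsilon-4\varepsilon\sum_{k\ne m}\frac{1}{(c_k-c_m)^4t^2}+O_\varepsilon(t^{-3}),$$ $$-\mathrm{Im}\,z_k^{\varepsilon,+}(t)=\frac{4\varepsilon}{(c_k-c_m)^4t^2}+O_\varepsilon(t^{-3}),\qquad k\ne m.$$ The same formulas hold as $t\to-\infty$ (with errors $O_\varepsilon(|t|^{-3})$) for the eigenvalue branches $z_k^{\varepsilon,-}(t)$ labelled by $$z_k^{\varepsilon,-}(t)=(c_k-c_m)t+\gamma_k-i\varepsilon\delta_{km}+O_\varepsilon(|t|^{-1}).$$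
   Context: $O_\varepsilon$ denotes a bound whose implied constant may depend on $\varepsilon$ (and on $N$, $m$, the $c_j$ and the $\gamma_j$) but not on $t$. The matrix is $\mathcal M_\varepsilon(t)=H(t)-c_mtI-i\varepsilon e_me_m^*$, where $H(t)_{jk}=(\gamma_j+c_jt)\delta_{jk}+\frac{2i(1-\delta_{jk})}{c_j-c_k}$. Since the $c_k$ are distinct, for $|t|$ large the eigenvalues are simple and the stated asymptotics determine the labelling uniquely. *)

theory Defs
  imports
    "HOL-Library.Landau_Symbols"
    "Jordan_Normal_Form.Spectral_Radius"
begin

text \<open>Indices run over \<open>{..<N}\<close> (not \<open>{1..N}\<close>), as for the entries of type \<open>mat\<close>.\<close>

definition perturbed_matrix ::
    "nat \<Rightarrow> (nat \<Rightarrow> real) \<Rightarrow> (nat \<Rightarrow> real) \<Rightarrow> nat \<Rightarrow> real \<Rightarrow> real \<Rightarrow> complex mat" where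
  "perturbed_matrix N c \<gamma> m \<epsilon> t = mat N N (\<lambda>(j, k).
     if j = k
     then complex_of_real (\<gamma> j + (c j - c m) * t) - (if j = m then \<i> * complex_of_real \<epsilon> else 0)
     else 2 * \<i> / complex_of_real (c j - c k))"

text \<open>
  The filter \<open>F\<close> is \<open>at_top\<close> for the branches \<open>z\<^sup>+\<close> and \<open>at_bot\<close> for the branches \<open>z\<^sup>-\<close>.
  Since \<open>z\<close> is a total function, its values are constrained only eventually along \<open>F\<close>.
  Being in bijection with \<open>N\<close> indices, the eigenvalues of the \<open>N \<times> N\<close> matrix are then
  all simple, so that no multiplicities have to be recorded.
\<close>

definition eigenvalue_branches ::
    "real filter \<Rightarrow> nat \<Rightarrow> (nat \<Rightarrow> real) \<Rightarrow> (nat \<Rightarrow> real) \<Rightarrow> nat \<Rightarrow> real \<Rightarrow>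
      (nat \<Rightarrow> real \<Rightarrow> complex) \<Rightarrow> bool" where
  "eigenvalue_branches F N c \<gamma> m \<epsilon> z \<longleftrightarrow>
     (\<forall>\<^sub>F t in F. bij_betw (\<lambda>k. z k t) {..<N} (spectrum (perturbed_matrix N c \<gamma> m \<epsilon> t))) \<and>
     (\<forall>k<N. (\<lambda>t. z k t - (complex_of_real ((c k - c m) * t + \<gamma> k)
                            - (if k = m then \<i> * complex_of_real \<epsilon> else 0)))
              \<in> O[F](\<lambda>t. complex_of_real (1 / \<bar>t\<bar>)))"

end

(*
  An eigenvector v of z satisfies -Im z * |v|^2 = eps * |v_m|^2, because the off-diagonal part of
  the matrix is Hermitian.  For z near the k-th diagonal entry and v normalised by v_k = 1, the
  rows j ~= k give v_j = 2i / ((c_j - c_k) (c_k - c_j) t) + O(t^-2), so that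
  |v_j|^2 = 4 / ((c_j - c_k)^4 t^2) + O(t^-3); both expansions follow.
*)

theory Submission
  imports Defs
begin

text \<open>That the N eigenvalues sit next to the N diagonal entries must itself be proved:
  Gershgorin discs cover the spectrum, but a disc might be empty. Instead of counting by continuity
  of eigenvalues along a deformation, a determinant estimate at each diagonal entry rules out empty
  discs; for large |t| the discs are disjoint, so each holds exactly one eigenvalue. All estimates
  are uniform over the eigenvalues within a fixed distance of a diagonal entry and mention no
  branch. Hence they give both the existence of branches and the expansions for every admissible
  labelling. They are stated in |t| along \<open>at_infinity\<close>, so the two signs of t need no
  separate arguments. An error of order t^-2 in v_j is enough for an error of order t^-3 in its
  squared modulus, because v_j is itself of order 1/t.\<close>

section \<open>Linear algebra: Gershgorin discs and determinant bounds\<close>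

lemma spectrum_obtain_coords:
  fixes A :: "complex mat"
  assumes A: "A \<in> carrier_mat n n" and z: "z \<in> spectrum A"
  obtains v where "\<exists>i<n. v i \<noteq> 0" "\<And>i. i < n \<Longrightarrow> (\<Sum>j<n. A $$ (i, j) * v j) = z * v i"
proof -
  obtain w where w: "w \<in> carrier_vec n" "w \<noteq> 0\<^sub>v n" "A *\<^sub>v w = z \<cdot>\<^sub>v w"
    using A z by (auto simp: spectrum_def eigenvalue_def eigenvector_def)
  have "\<exists>i<n. w $ i \<noteq> 0"
    using w by (metis carrier_vecD eq_vecI index_zero_vec)
  moreover have "(\<Sum>j<n. A $$ (i, j) * w $ j) = z * w $ i" if "i < n" for i
  proof -
    have "(A *\<^sub>v w) $ i = (\<Sum>j<n. A $$ (i, j) * w $ j)"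
      using A w(1) that by (auto simp: scalar_prod_def lessThan_atLeast0 intro!: sum.cong)
    then show ?thesis
      using w that by simp
  qed
  ultimately show ?thesis
    using that by blast
qed

lemma obtain_max_norm:
  fixes v :: "nat \<Rightarrow> complex"
  assumes "\<exists>i<n. v i \<noteq> 0"
  obtains p where "p < n" "v p \<noteq> 0" "\<And>j. j < n \<Longrightarrow> norm (v j) \<le> norm (v p)"
proof -
  obtain i where i: "i < n" "v i \<noteq> 0"
    using assms by blast
  let ?S = "(\<lambda>j. norm (v j)) ` {..<n}"
  have fin: "finite ?S" "?S \<noteq> {}"
    using i by auto
  obtain p where p: "p < n" "norm (v p) = Max ?S"
    using Max_in[OF fin] by auto
  have le: "norm (v j) \<le> norm (v p)" if "j < n" for j
    using Max_ge[OF fin(1)] p that by simp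
  then have "v p \<noteq> 0"
    using i by (metis norm_le_zero_iff norm_zero)
  then show ?thesis
    using that p(1) le by blast
qed

text \<open>In the row of a largest coordinate of an eigenvector, every other coordinate can be
  replaced by the largest one, which then cancels.\<close>

lemma gershgorin:
  fixes A :: "complex mat"
  assumes A: "A \<in> carrier_mat n n" and z: "z \<in> spectrum A"
  obtains i where "i < n" "norm (z - A $$ (i, i)) \<le> (\<Sum>j\<in>{..<n} - {i}. norm (A $$ (i, j)))"
proof -
  obtain v where v: "\<exists>i<n. v i \<noteq> 0"
    and eq: "\<And>i. i < n \<Longrightarrow> (\<Sum>j<n. A $$ (i, j) * v j) = z * v i"
    using spectrum_obtain_coords[OF A z] by blast
  obtain p where p: "p < n" "v p \<noteq> 0" and max: "\<And>j. j < n \<Longrightarrow> norm (v j) \<le> norm (v p)"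
    using obtain_max_norm[OF v] by blast
  let ?R = "{..<n} - {p}"
  have "(z - A $$ (p, p)) * v p = (\<Sum>j\<in>?R. A $$ (p, j) * v j)"
    using eq[OF p(1)] p(1) by (simp add: sum.remove[of "{..<n}" p] algebra_simps)
  then have "norm (z - A $$ (p, p)) * norm (v p) = norm (\<Sum>j\<in>?R. A $$ (p, j) * v j)"
    by (metis norm_mult)
  also have "\<dots> \<le> (\<Sum>j\<in>?R. norm (A $$ (p, j)) * norm (v p))"
    by (rule sum_norm_le) (auto simp: norm_mult intro!: mult_left_mono max)
  also have "\<dots> = (\<Sum>j\<in>?R. norm (A $$ (p, j))) * norm (v p)"
    by (simp add: sum_distrib_right)
  finally have "norm (z - A $$ (p, p)) \<le> (\<Sum>j\<in>?R. norm (A $$ (p, j)))"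
    using p(2) by simp
  then show ?thesis
    using that p(1) by blast
qed

text \<open>Each Leibniz term takes exactly one factor from row \<open>k\<close> and
  \<open>n - 1\<close> factors from the other rows. A single row that stays bounded while the others
  grow thus saves one power of the growth rate.\<close>

lemma norm_det_le:
  fixes A :: "complex mat"
  assumes A: "A \<in> carrier_mat n n" and k: "k < n"
    and b: "\<And>i j. i < n \<Longrightarrow> j < n \<Longrightarrow> norm (A $$ (i, j)) \<le> b"
    and a: "\<And>j. j < n \<Longrightarrow> norm (A $$ (k, j)) \<le> a"
  shows "norm (det A) \<le> fact n * (a * b ^ (n - 1))"
proof -
  let ?P = "{p. p permutes {0..<n}}"
  have "norm (det A) \<le> (\<Sum>p\<in>?P. a * b ^ (n - 1))"
    unfolding det_def'[OF A]
  proof (rule sum_norm_le)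
    fix p assume "p \<in> ?P"
    then have p: "p i < n" if "i < n" for i
      using that permutes_in_image by fastforce
    have "norm (signof p * (\<Prod>i = 0..<n. A $$ (i, p i))) = (\<Prod>i\<in>{0..<n}. norm (A $$ (i, p i)))"
      by (simp add: norm_mult prod_norm sign_def)
    also have "\<dots> = norm (A $$ (k, p k)) * (\<Prod>i\<in>{0..<n} - {k}. norm (A $$ (i, p i)))"
      using k by (intro prod.remove) auto
    also have "\<dots> \<le> a * (\<Prod>i\<in>{0..<n} - {k}. b)"
      using a[OF p[OF k]] p b
      by (intro mult_mono prod_mono prod_nonneg) (auto intro: order_trans[OF norm_ge_zero])
    also have "\<dots> = a * b ^ (n - 1)"
      using k by simp
    finally show "norm (signof p * (\<Prod>i = 0..<n. A $$ (i, p i))) \<le> a * b ^ (n - 1)" .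
  qed
  also have "\<dots> = fact n * (a * b ^ (n - 1))"
    by (simp add: card_permutations[of _ n])
  finally show ?thesis .
qed

text \<open>The determinant of \<open>A - x\<close> is, up to sign, the product of the differences
  between x and the \<open>n\<close> eigenvalues counted with multiplicity, and each factor is at
  least as large as the smallest one.\<close>

lemma dist_spectrum_power_le_det:
  fixes A :: "complex mat"
  assumes A: "A \<in> carrier_mat n n" and n: "n > 0"
  obtains z where "z \<in> spectrum A" "norm (z - x) ^ n \<le> norm (det (char_matrix A x))"
proof -
  obtain as where as: "char_poly A = (\<Prod>a\<leftarrow>as. [:- a, 1:])" "length as = n"
    using char_poly_factorized[OF A] by blast
  have spec: "spectrum A = set as"
    unfolding spectrum_root_char_poly[OF A] as(1) by (auto simp: poly_prod_list)
  have "set as \<noteq> {}"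
    using as(2) n by auto
  then obtain z where z: "z \<in> set as" "\<And>w. w \<in> set as \<Longrightarrow> norm (z - x) \<le> norm (w - x)"
    using arg_min_if_finite[of "set as" "\<lambda>w. norm (w - x)"]
    by (metis List.finite_set linorder_not_le)
  \<comment> \<open>Stated for all lists with entries in \<open>set as\<close>, so that the
    induction keeps \<open>z\<close> fixed as the nearest of all eigenvalues.\<close>
  have "norm (z - x) ^ length bs \<le> norm (poly (\<Prod>a\<leftarrow>bs. [:- a, 1:]) x)" if "set bs \<subseteq> set as" for bs
    using that
  proof (induction bs)
    case (Cons b bs)
    then have "norm (z - x) * norm (z - x) ^ length bs
        \<le> norm (x - b) * norm (poly (\<Prod>a\<leftarrow>bs. [:- a, 1:]) x)"
      using z(2)[of b] by (intro mult_mono) (auto simp: norm_minus_commute)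
    then show ?case
      by (simp add: norm_mult[symmetric] algebra_simps)
  qed simp
  from this[of as] have "norm (z - x) ^ n \<le> norm (poly (char_poly A) x)"
    using as by simp
  also have "\<dots> = norm (det (char_matrix A x))"
  proof -
    \<comment> \<open>The characteristic polynomial at x is the determinant of minus this matrix;
      the resulting sign has modulus 1.\<close>
    have "- char_matrix A x = (-1) \<cdot>\<^sub>m char_matrix A x"
      by auto
    then show ?thesis
      by (simp add: char_poly_matrix[OF A] norm_mult norm_power)
  qed
  finally show ?thesis
    using that z(1) spec by blast
qed

lemma eventually_le_abs: "\<forall>\<^sub>F t :: real in at_infinity. b \<le> \<bar>t\<bar>"
  by (rule eventually_at_infinityI[of b]) simp

section \<open>The matrix family: diagonal, Hermitian coupling and uniform constants\<close>

locale perturbed_family =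
  fixes N m :: nat and c \<gamma> :: "nat \<Rightarrow> real" and \<epsilon> :: real
  assumes inj_c: "inj_on c {..<N}" and m_less: "m < N"
begin

definition diag :: "real \<Rightarrow> nat \<Rightarrow> complex" where
  "diag t k = complex_of_real ((c k - c m) * t + \<gamma> k) - (if k = m then \<i> * complex_of_real \<epsilon> else 0)"

text \<open>The diagonal of the coupling vanishes because \<open>x / 0 = 0\<close>.\<close>

definition coupling :: "nat \<Rightarrow> nat \<Rightarrow> complex" where
  "coupling j k = 2 * \<i> / complex_of_real (c j - c k)"

text \<open>Summing over all entries gives one constant that bounds every entry and every row sum,
  hence also every Gershgorin radius.\<close>

definition coupling_bound :: real where
  "coupling_bound = (\<Sum>j<N. \<Sum>k<N. norm (coupling j k))"

text \<open>Differences of diagonal entries are linear in t up to their value at t = 0; the factor 2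
  pays for the two entries involved.\<close>

definition offset_bound :: real where
  "offset_bound = 2 * (\<Sum>j<N. norm (diag 0 j))"

text \<open>The inserted 1 keeps the minimum over a nonempty set when N = 1.\<close>

definition gap :: real where
  "gap = Min (insert 1 ((\<lambda>(j, k). \<bar>c j - c k\<bar>) ` {(j, k). j < N \<and> k < N \<and> j \<noteq> k}))"

text \<open>The eigenvector equation with the diagonal moved to the left, so that a lower bound on
  \<open>z - diag t j\<close> immediately bounds the coordinate \<open>v j\<close>.\<close>

definition eigvec :: "real \<Rightarrow> complex \<Rightarrow> (nat \<Rightarrow> complex) \<Rightarrow> bool" where
  "eigvec t z v \<longleftrightarrow> (\<exists>j<N. v j \<noteq> 0) \<and>
     (\<forall>j<N. (z - diag t j) * v j = (\<Sum>k<N. coupling j k * v k))"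

abbreviation M :: "real \<Rightarrow> complex mat" where
  "M t \<equiv> perturbed_matrix N c \<gamma> m \<epsilon> t"

lemma M_carrier: "M t \<in> carrier_mat N N"
  by (simp add: perturbed_matrix_def)

lemma M_entry: "j < N \<Longrightarrow> k < N \<Longrightarrow> M t $$ (j, k) = (if j = k then diag t j else coupling j k)"
  by (simp add: perturbed_matrix_def diag_def coupling_def algebra_simps)

lemma coupling_self [simp]: "coupling j j = 0"
  by (simp add: coupling_def)

text \<open>Conjugating \<i> and exchanging the indices in the denominator each change the sign, so
  the coupling is Hermitian.\<close>

lemma cnj_coupling: "cnj (coupling j k) = coupling k j"
  by (cases "c j = c k") (simp_all add: coupling_def field_simps)

lemma sum_norm_coupling_le: "j < N \<Longrightarrow> (\<Sum>k<N. norm (coupling j k)) \<le> coupling_bound"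
  unfolding coupling_bound_def
  by (rule member_le_sum[where f = "\<lambda>j. \<Sum>k<N. norm (coupling j k)"]) (auto intro: sum_nonneg)

lemma coupling_bound_nonneg: "0 \<le> coupling_bound"
  unfolding coupling_bound_def by (intro sum_nonneg) auto

lemma norm_coupling_le:
  assumes "j < N" "k < N"
  shows "norm (coupling j k) \<le> coupling_bound"
proof -
  have "norm (coupling j k) \<le> (\<Sum>k<N. norm (coupling j k))"
    using assms by (intro member_le_sum) auto
  also have "\<dots> \<le> coupling_bound"
    using assms by (intro sum_norm_coupling_le)
  finally show ?thesis .
qed

text \<open>The index set \<open>S\<close> is free because both full rows and rows without the
  dominant coordinate have to be bounded.\<close>

lemma norm_coupling_sum_le:
  assumes "j < N" "S \<subseteq> {..<N}" "\<And>k. k \<in> S \<Longrightarrow> norm (v k) \<le> b" "0 \<le> b"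
  shows "norm (\<Sum>k\<in>S. coupling j k * v k) \<le> coupling_bound * b"
proof -
  have "norm (\<Sum>k\<in>S. coupling j k * v k) \<le> (\<Sum>k\<in>S. norm (coupling j k) * b)"
    by (rule sum_norm_le) (auto simp: norm_mult intro!: mult_left_mono assms)
  also have "\<dots> \<le> (\<Sum>k<N. norm (coupling j k)) * b"
    unfolding sum_distrib_right[symmetric]
    using assms by (intro mult_right_mono sum_mono2) auto
  also have "\<dots> \<le> coupling_bound * b"
    using assms by (intro mult_right_mono sum_norm_coupling_le)
  finally show ?thesis .
qed

lemma gap_pos: "gap > 0"
  and gap_le: "j < N \<Longrightarrow> k < N \<Longrightarrow> j \<noteq> k \<Longrightarrow> gap \<le> \<bar>c j - c k\<bar>"
proof -
  have fin: "finite {(j, k). j < N \<and> k < N \<and> j \<noteq> k}"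
    by (rule finite_subset[of _ "{..<N} \<times> {..<N}"]) auto
  show "gap > 0"
    unfolding gap_def using fin inj_c by (subst Min_gr_iff) (auto simp: inj_on_def)
  show "gap \<le> \<bar>c j - c k\<bar>" if "j < N" "k < N" "j \<noteq> k"
    unfolding gap_def using fin that by (intro Min_le) auto
qed

lemma norm_diag_diff_le:
  assumes "j < N" "k < N"
  shows "norm (diag t j - diag t k - complex_of_real ((c j - c k) * t)) \<le> offset_bound"
proof -
  have "diag t j - diag t k - complex_of_real ((c j - c k) * t) = diag 0 j - diag 0 k"
    by (simp add: diag_def algebra_simps)
  also have "norm \<dots> \<le> norm (diag 0 j) + norm (diag 0 k)"
    by (rule norm_triangle_ineq4)
  also have "\<dots> \<le> offset_bound"
    using member_le_sum[of j "{..<N}" "\<lambda>j. norm (diag 0 j)"] assms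
      member_le_sum[of k "{..<N}" "\<lambda>j. norm (diag 0 j)"]
    by (auto simp: offset_bound_def)
  finally show ?thesis .
qed

lemma offset_bound_nonneg: "0 \<le> offset_bound"
  unfolding offset_bound_def by (intro mult_nonneg_nonneg sum_nonneg) auto

text \<open>The linear part separates two entries by at least \<open>gap * |t|\<close>, and half of
  this eventually absorbs the bounded offset.\<close>

lemma diag_separated:
  "\<forall>\<^sub>F t in at_infinity. \<forall>j<N. \<forall>k<N. j \<noteq> k \<longrightarrow> gap / 2 * \<bar>t\<bar> \<le> norm (diag t j - diag t k)"
proof (rule eventually_at_infinityI, intro allI impI)
  fix t :: real and j k
  assume t: "2 * offset_bound / gap \<le> norm t" and jk: "j < N" "k < N" "j \<noteq> k"
  have "gap * \<bar>t\<bar> \<le> \<bar>c j - c k\<bar> * \<bar>t\<bar>"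
    using gap_le[OF jk] by (intro mult_right_mono) auto
  also have "\<dots> = norm (complex_of_real ((c j - c k) * t))"
    by (simp only: norm_of_real abs_mult)
  also have "\<dots> \<le> norm (diag t j - diag t k) + offset_bound"
    using norm_diag_diff_le[OF jk(1,2), of t]
      norm_triangle_ineq4[of "diag t j - diag t k"
        "diag t j - diag t k - complex_of_real ((c j - c k) * t)"] by simp
  finally show "gap / 2 * \<bar>t\<bar> \<le> norm (diag t j - diag t k)"
    using t gap_pos by (simp add: field_simps)
qed

section \<open>Localisation of the spectrum near the diagonal\<close>

lemma spectrum_obtain_eigvec:
  assumes "z \<in> spectrum (M t)"
  obtains v where "eigvec t z v"
proof -
  obtain v where v: "\<exists>i<N. v i \<noteq> 0"
    and eq: "\<And>i. i < N \<Longrightarrow> (\<Sum>j<N. M t $$ (i, j) * v j) = z * v i"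
    using spectrum_obtain_coords[OF M_carrier assms] by blast
  have "(z - diag t i) * v i = (\<Sum>k<N. coupling i k * v k)" if i: "i < N" for i
  proof -
    have "z * v i = diag t i * v i + (\<Sum>k\<in>{..<N} - {i}. coupling i k * v k)"
      unfolding eq[OF i, symmetric] using i
      by (simp add: sum.remove[of "{..<N}" i] M_entry)
    moreover have "(\<Sum>k<N. coupling i k * v k) = (\<Sum>k\<in>{..<N} - {i}. coupling i k * v k)"
      using i by (simp add: sum.remove[of "{..<N}" i])
    ultimately show ?thesis
      by (simp add: algebra_simps)
  qed
  with v that show ?thesis
    by (auto simp: eigvec_def)
qed

lemma spectrum_near_diag:
  assumes "z \<in> spectrum (M t)"
  obtains i where "i < N" "norm (z - diag t i) \<le> coupling_bound"
proof -
  obtain i where i: "i < N" "norm (z - M t $$ (i, i)) \<le> (\<Sum>j\<in>{..<N} - {i}. norm (M t $$ (i, j)))"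
    using gershgorin[OF M_carrier assms] by blast
  have "(\<Sum>j\<in>{..<N} - {i}. norm (M t $$ (i, j))) = (\<Sum>j\<in>{..<N} - {i}. norm (coupling i j))"
    using i by (intro sum.cong) (auto simp: M_entry)
  also have "\<dots> \<le> (\<Sum>j<N. norm (coupling i j))"
    by (intro sum_mono2) auto
  also have "\<dots> \<le> coupling_bound"
    using i by (intro sum_norm_coupling_le)
  finally show ?thesis
    using i that by (auto simp: M_entry)
qed

text \<open>
  At \<open>x = diag t k\<close> row \<open>k\<close> of \<open>M t - x\<close> is bounded, so its determinant is \<open>O(t\<^sup>N\<^sup>-\<^sup>1)\<close>;
  if all eigenvalues lay in the other Gershgorin discs, it would be of order at least \<open>t\<^sup>N\<close>.
\<close>

lemma exists_eigenvalue_near_diag: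
  "\<forall>\<^sub>F t in at_infinity. \<forall>k<N. \<exists>z\<in>spectrum (M t). norm (z - diag t k) \<le> coupling_bound"
proof -
  \<comment> \<open>For |t| >= 1 every entry of \<open>M t - diag t k\<close> is at most
    \<open>H * |t|\<close>; \<open>Q\<close> collects the constants of the resulting determinant
    bound \<open>Q * |t| ^ (N - 1)\<close>.\<close>
  define H where "H = coupling_bound + offset_bound + 2 * (\<Sum>j<N. \<bar>c j\<bar>)"
  define Q where "Q = fact N * coupling_bound * H ^ (N - 1)"
  \<comment> \<open>The three thresholds let constants be absorbed into multiples of |t|, make the
    disc radius at most a quarter of \<open>gap * |t|\<close>, and let t^N win over t^(N-1); the
    \<open>+ 1\<close> makes the last comparison strict.\<close>
  have "\<forall>\<^sub>F t in at_infinity. max 1 (max (4 * coupling_bound / gap) (Q / (gap / 4) ^ N + 1)) \<le> \<bar>t\<bar>"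
    by (rule eventually_le_abs)
  with diag_separated show ?thesis
  proof eventually_elim
    case (elim t)
    have t: "1 \<le> \<bar>t\<bar>" "4 * coupling_bound \<le> gap * \<bar>t\<bar>" "Q < (gap / 4) ^ N * \<bar>t\<bar>"
    proof -
      have "Q / (gap / 4) ^ N < \<bar>t\<bar>"
        using elim(2) by simp
      then show "Q < (gap / 4) ^ N * \<bar>t\<bar>"
        using gap_pos by (simp add: divide_less_eq mult.commute)
    qed (use elim(2) gap_pos in \<open>simp_all add: divide_le_eq mult.commute\<close>)
    show ?case
    proof (intro allI impI)
      fix k assume k: "k < N"
      let ?A = "char_matrix (M t) (diag t k)"
      have dimM: "dim_row (M t) = N" "dim_col (M t) = N"
        using M_carrier[of t] by auto
      have A: "?A \<in> carrier_mat N N"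
        using M_carrier by simp
      have entry: "?A $$ (i, j) = (if i = j then diag t i - diag t k else coupling i j)"
        if "i < N" "j < N" for i j
        using that by (simp add: char_matrix_def dimM M_entry)
      have diff: "norm (diag t i - diag t k) \<le> (offset_bound + 2 * (\<Sum>j<N. \<bar>c j\<bar>)) * \<bar>t\<bar>" if i: "i < N" for i
      proof -
        have "norm (diag t i - diag t k) \<le> offset_bound + norm (complex_of_real ((c i - c k) * t))"
          using norm_diag_diff_le[OF i k, of t] norm_triangle_sub[of "diag t i - diag t k"
            "complex_of_real ((c i - c k) * t)"] by linarith
        also have "norm (complex_of_real ((c i - c k) * t)) = \<bar>c i - c k\<bar> * \<bar>t\<bar>"
          by (simp only: norm_of_real abs_mult)
        also have "\<dots> \<le> 2 * (\<Sum>j<N. \<bar>c j\<bar>) * \<bar>t\<bar>"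
          using member_le_sum[of i "{..<N}" "\<lambda>j. \<bar>c j\<bar>"] i k
            member_le_sum[of k "{..<N}" "\<lambda>j. \<bar>c j\<bar>"]
          by (intro mult_right_mono) auto
        also have "offset_bound \<le> offset_bound * \<bar>t\<bar>"
          using t(1) offset_bound_nonneg by (simp add: mult_le_cancel_left1)
        finally show ?thesis
          by (simp add: algebra_simps)
      qed
      have b: "norm (?A $$ (i, j)) \<le> H * \<bar>t\<bar>" if ij: "i < N" "j < N" for i j
      proof -
        have H: "H * \<bar>t\<bar> = coupling_bound * \<bar>t\<bar> + (offset_bound + 2 * (\<Sum>j<N. \<bar>c j\<bar>)) * \<bar>t\<bar>"
          by (simp add: H_def algebra_simps)
        have "coupling_bound \<le> coupling_bound * \<bar>t\<bar>"
          using t(1) coupling_bound_nonneg by (simp add: mult_le_cancel_left1)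
        moreover have "0 \<le> (offset_bound + 2 * (\<Sum>j<N. \<bar>c j\<bar>)) * \<bar>t\<bar>"
          using offset_bound_nonneg by (intro mult_nonneg_nonneg add_nonneg_nonneg sum_nonneg) auto
        moreover have "norm (?A $$ (i, j)) \<le> norm (diag t i - diag t k) \<or> norm (?A $$ (i, j)) \<le> coupling_bound"
          using norm_coupling_le[OF ij] entry[OF ij] by simp
        ultimately show ?thesis
          using diff[OF ij(1)] coupling_bound_nonneg unfolding H by linarith
      qed
      have a: "norm (?A $$ (k, j)) \<le> coupling_bound" if "j < N" for j
        using that k norm_coupling_le[OF k that] coupling_bound_nonneg by (simp add: entry)
      \<comment> \<open>An eigenvalue as close to \<open>diag t k\<close> as the determinant
        enforces. It lies in some disc \<open>i\<close>, and the growth rates leave only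
        \<open>i = k\<close>.\<close>
      obtain z where z: "z \<in> spectrum (M t)" "norm (z - diag t k) ^ N \<le> norm (det ?A)"
        using dist_spectrum_power_le_det[OF M_carrier] k by (metis not_less_zero gr0I)
      obtain i where i: "i < N" "norm (z - diag t i) \<le> coupling_bound"
        using spectrum_near_diag[OF z(1)] by blast
      have "i = k"
      proof (rule ccontr)
        assume ne: "i \<noteq> k"
        have "gap / 2 * \<bar>t\<bar> \<le> norm (diag t i - diag t k)"
          using elim(1) i k ne by blast
        also have "\<dots> \<le> norm (z - diag t k) + norm (z - diag t i)"
          using norm_triangle_ineq4[of "z - diag t k" "z - diag t i"] by simp
        \<comment> \<open>Of the separation \<open>gap / 2 * |t|\<close> the disc radius uses up at
          most half.\<close>
        finally have "gap / 4 * \<bar>t\<bar> \<le> norm (z - diag t k)"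
          using i(2) t(2) by simp
        then have "(gap / 4 * \<bar>t\<bar>) ^ N \<le> norm (z - diag t k) ^ N"
          using gap_pos by (intro power_mono) auto
        also have "\<dots> \<le> fact N * (coupling_bound * (H * \<bar>t\<bar>) ^ (N - 1))"
          using z(2) norm_det_le[OF A k b a] by simp
        also have "\<dots> = Q * \<bar>t\<bar> ^ (N - 1)"
          by (simp add: Q_def power_mult_distrib)
        also have "\<dots> < (gap / 4) ^ N * \<bar>t\<bar> * \<bar>t\<bar> ^ (N - 1)"
          using t by (intro mult_strict_right_mono) auto
        also have "\<dots> = (gap / 4 * \<bar>t\<bar>) ^ N"
          using power_minus_mult[of N "\<bar>t\<bar>"] k
          by (simp only: power_mult_distrib mult.assoc mult.commute[of "\<bar>t\<bar>"])
        finally show False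
          by simp
      qed
      then show "\<exists>z\<in>spectrum (M t). norm (z - diag t k) \<le> coupling_bound"
        using z(1) i(2) by blast
    qed
  qed
qed

section \<open>Eigenvectors to first order in 1/t\<close>

text \<open>An eigenvalue near \<open>diag t k\<close> is at distance of order |t| from the other
  diagonal entries, so row \<open>j\<close> forces \<open>v j\<close> to be of order 1/|t| relative
  to the largest coordinate. The radius \<open>R\<close> is free: the Gershgorin radius serves the
  construction of branches, the radius 1 serves given branches.\<close>

lemma eigvec_concentrated:
  "\<exists>C\<ge>0. \<forall>\<^sub>F t in at_infinity. \<forall>k<N. \<forall>z\<in>spectrum (M t). norm (z - diag t k) \<le> R \<longrightarrow>
     (\<exists>v. eigvec t z v \<and> v k = 1 \<and> (\<forall>j<N. j \<noteq> k \<longrightarrow> norm (v j) \<le> C / \<bar>t\<bar>))"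
proof (intro exI conjI)
  \<comment> \<open>The quotient of the row bound \<open>coupling_bound\<close> by the distance
    \<open>gap / 4 * |t|\<close>, without its factor 1/|t|.\<close>
  define C where "C = 4 * coupling_bound / gap"
  show "0 \<le> C"
    using coupling_bound_nonneg gap_pos by (simp add: C_def)
  have "\<forall>\<^sub>F t in at_infinity. max 1 (max (4 * R / gap) (C + 1)) \<le> \<bar>t\<bar>"
    by (rule eventually_le_abs)
  with diag_separated show "\<forall>\<^sub>F t in at_infinity. \<forall>k<N. \<forall>z\<in>spectrum (M t).
      norm (z - diag t k) \<le> R \<longrightarrow>
      (\<exists>v. eigvec t z v \<and> v k = 1 \<and> (\<forall>j<N. j \<noteq> k \<longrightarrow> norm (v j) \<le> C / \<bar>t\<bar>))"
  proof eventually_elim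
    case (elim t)
    have t: "1 \<le> \<bar>t\<bar>" "4 * R \<le> gap * \<bar>t\<bar>" "C / \<bar>t\<bar> < 1"
      using elim(2) gap_pos by (auto simp: divide_le_eq mult.commute)
    show ?case
    proof (intro allI ballI impI)
      fix k z assume k: "k < N" and "z \<in> spectrum (M t)" and R: "norm (z - diag t k) \<le> R"
      then obtain v where v: "eigvec t z v"
        using spectrum_obtain_eigvec by blast
      obtain p where p: "p < N" "v p \<noteq> 0" and max: "\<And>j. j < N \<Longrightarrow> norm (v j) \<le> norm (v p)"
        using obtain_max_norm[of N v] v by (auto simp: eigvec_def)
      have small: "norm (v j) \<le> C / \<bar>t\<bar> * norm (v p)" if j: "j < N" "j \<noteq> k" for j
      proof -
        have "gap / 2 * \<bar>t\<bar> \<le> norm (diag t j - diag t k)"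
          using elim(1) j k by blast
        also have "\<dots> \<le> norm (z - diag t k) + norm (z - diag t j)"
          using norm_triangle_ineq4[of "z - diag t k" "z - diag t j"] by simp
        finally have "gap / 4 * \<bar>t\<bar> \<le> norm (z - diag t j)"
          using R t(2) by simp
        then have "gap / 4 * \<bar>t\<bar> * norm (v j) \<le> norm ((z - diag t j) * v j)"
          unfolding norm_mult by (rule mult_right_mono) simp
        also have "\<dots> \<le> coupling_bound * norm (v p)"
          using v j max norm_coupling_sum_le[OF j(1), of "{..<N}" v "norm (v p)"]
          by (auto simp: eigvec_def)
        finally show ?thesis
          using t(1) gap_pos by (simp add: C_def field_simps)
      qed
      \<comment> \<open>A largest coordinate at another index would be strictly smaller than itself,
        since \<open>C / |t| < 1\<close>. Hence \<open>v k\<close> is nonzero and can be normalised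
        to 1.\<close>
      have "p = k"
      proof (rule ccontr)
        assume "p \<noteq> k"
        then have "1 * norm (v p) \<le> C / \<bar>t\<bar> * norm (v p)"
          using small p by simp
        then show False
          using p(2) t(3) by (simp only: mult_le_cancel_right) simp
      qed
      define w where "w j = v j / v k" for j
      have "eigvec t z w"
        using v k p \<open>p = k\<close> unfolding eigvec_def w_def
        by (auto simp: sum_divide_distrib[symmetric] intro!: exI[of _ k])
      moreover have "w k = 1"
        using p \<open>p = k\<close> by (simp add: w_def)
      moreover have "norm (w j) \<le> C / \<bar>t\<bar>" if "j < N" "j \<noteq> k" for j
        using small[OF that] p \<open>p = k\<close> by (simp add: w_def norm_divide divide_le_eq)
      ultimately show "\<exists>v. eigvec t z v \<and> v k = 1 \<and> (\<forall>j<N. j \<noteq> k \<longrightarrow> norm (v j) \<le> C / \<bar>t\<bar>)"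
        by blast
    qed
  qed
qed

text \<open>A bootstrap: once the coordinates other than \<open>k\<close> are of order 1/|t|, row
  \<open>k\<close> improves the distance from \<open>R\<close> to order 1/|t|, and row
  \<open>j\<close> determines \<open>v j\<close> up to order t^-2.\<close>

lemma eigvec_first_order:
  "\<exists>C\<ge>0. \<forall>\<^sub>F t in at_infinity. \<forall>k<N. \<forall>z\<in>spectrum (M t). norm (z - diag t k) \<le> R \<longrightarrow>
     norm (z - diag t k) \<le> C / \<bar>t\<bar> \<and>
     (\<exists>v. eigvec t z v \<and> v k = 1 \<and> (\<forall>j<N. j \<noteq> k \<longrightarrow> norm (v j) \<le> C / \<bar>t\<bar> \<and>
       norm (v j - coupling j k / complex_of_real ((c k - c j) * t)) \<le> C / t\<^sup>2))"
proof -
  obtain D where D: "D \<ge> 0" and ev: "\<forall>\<^sub>F t in at_infinity. \<forall>k<N. \<forall>z\<in>spectrum (M t).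
      norm (z - diag t k) \<le> R \<longrightarrow>
      (\<exists>v. eigvec t z v \<and> v k = 1 \<and> (\<forall>j<N. j \<noteq> k \<longrightarrow> norm (v j) \<le> D / \<bar>t\<bar>))"
    using eigvec_concentrated by blast
  \<comment> \<open>\<open>E / |t|\<close> bounds the error in row \<open>j\<close>:
    \<open>coupling_bound\<close> stems from the coordinates other than \<open>k\<close>, and
    \<open>|R| + offset_bound\<close> from replacing \<open>z - diag t j\<close> by
    \<open>(c k - c j) * t\<close>. The absolute value keeps \<open>E\<close> nonnegative for every
    \<open>R\<close>.\<close>
  define E where "E = (coupling_bound + \<bar>R\<bar> + offset_bound) * D"
  have E: "E \<ge> 0"
    using D coupling_bound_nonneg offset_bound_nonneg by (simp add: E_def)
  define C where "C = D + coupling_bound * D + E / gap"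
  have C: "D \<le> C" "coupling_bound * D \<le> C" "E / gap \<le> C" "C \<ge> 0"
    using D E gap_pos coupling_bound_nonneg by (auto simp: C_def intro: add_nonneg_nonneg)
  show ?thesis
  proof (intro exI conjI)
    show "C \<ge> 0" by fact
    have "\<forall>\<^sub>F t in at_infinity. 1 \<le> \<bar>t :: real\<bar>"
      by (rule eventually_le_abs)
    with ev show "\<forall>\<^sub>F t in at_infinity. \<forall>k<N. \<forall>z\<in>spectrum (M t). norm (z - diag t k) \<le> R \<longrightarrow>
     norm (z - diag t k) \<le> C / \<bar>t\<bar> \<and>
     (\<exists>v. eigvec t z v \<and> v k = 1 \<and> (\<forall>j<N. j \<noteq> k \<longrightarrow> norm (v j) \<le> C / \<bar>t\<bar> \<and>
       norm (v j - coupling j k / complex_of_real ((c k - c j) * t)) \<le> C / t\<^sup>2))"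
    proof eventually_elim
      case (elim t)
      show ?case
      proof (intro allI ballI impI)
        fix k z assume k: "k < N" and z: "z \<in> spectrum (M t)" and R: "norm (z - diag t k) \<le> R"
        then obtain v where v: "eigvec t z v" "v k = 1"
          and small: "\<And>j. j < N \<Longrightarrow> j \<noteq> k \<Longrightarrow> norm (v j) \<le> D / \<bar>t\<bar>"
          using elim(1) by blast
        have row: "(z - diag t j) * v j = coupling j k + (\<Sum>l\<in>{..<N} - {k}. coupling j l * v l)"
          if "j < N" for j
          using v k that by (simp add: eigvec_def sum.remove[of "{..<N}" k])
        have rest: "norm (\<Sum>l\<in>{..<N} - {k}. coupling j l * v l) \<le> coupling_bound * (D / \<bar>t\<bar>)"
          if "j < N" for j
          using D small that by (intro norm_coupling_sum_le) auto
        \<comment> \<open>As \<open>v k = 1\<close> and the coupling has zero diagonal, row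
          \<open>k\<close> expresses \<open>z - diag t k\<close> through the small coordinates
          alone.\<close>
        have "norm (z - diag t k) \<le> coupling_bound * D / \<bar>t\<bar>"
          using row[OF k] rest[OF k] v(2) by simp
        also have "\<dots> \<le> C / \<bar>t\<bar>"
          using C by (intro divide_right_mono) auto
        finally have 1: "norm (z - diag t k) \<le> C / \<bar>t\<bar>" .
        have 2: "norm (v j) \<le> C / \<bar>t\<bar>" if "j < N" "j \<noteq> k" for j
          using small[OF that] C(1) by (rule order_trans[OF _ divide_right_mono]) simp
        have 3: "norm (v j - coupling j k / complex_of_real ((c k - c j) * t)) \<le> C / t\<^sup>2"
          if j: "j < N" "j \<noteq> k" for j
        proof -
          let ?e = "complex_of_real ((c k - c j) * t)"
          have gap: "gap * \<bar>t\<bar> \<le> norm ?e"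
            using gap_le[of k j] j k by (simp only: norm_of_real abs_mult) (auto intro: mult_right_mono)
          have e0: "?e \<noteq> 0"
            using gap gap_pos elim(2) by (auto simp: mult_le_0_iff)
          have eq: "?e * v j - coupling j k = (\<Sum>l\<in>{..<N} - {k}. coupling j l * v l)
              - ((z - diag t k) + (diag t k - diag t j - ?e)) * v j"
            using row[OF j(1)] by (simp add: algebra_simps)
          have "norm ((z - diag t k) + (diag t k - diag t j - ?e)) \<le> \<bar>R\<bar> + offset_bound"
            using R norm_diag_diff_le[OF k j(1), of t] by (intro norm_triangle_mono) auto
          then have "norm (((z - diag t k) + (diag t k - diag t j - ?e)) * v j)
              \<le> (\<bar>R\<bar> + offset_bound) * (D / \<bar>t\<bar>)"
            unfolding norm_mult using small[OF j] offset_bound_nonneg by (intro mult_mono) auto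
          then have "norm (?e * v j - coupling j k)
              \<le> coupling_bound * (D / \<bar>t\<bar>) + (\<bar>R\<bar> + offset_bound) * (D / \<bar>t\<bar>)"
            unfolding eq using rest[OF j(1)]
            by (intro order_trans[OF norm_triangle_ineq4] add_mono) auto
          also have "\<dots> = E / \<bar>t\<bar>"
            by (simp add: E_def algebra_simps add_divide_distrib)
          finally have num: "norm (?e * v j - coupling j k) \<le> E / \<bar>t\<bar>" .
          have "v j - coupling j k / ?e = (?e * v j - coupling j k) / ?e"
            unfolding diff_divide_distrib nonzero_mult_div_cancel_left[OF e0] ..
          also have "norm \<dots> \<le> (E / \<bar>t\<bar>) / (gap * \<bar>t\<bar>)"
            unfolding norm_divide using num gap gap_pos elim(2) E by (intro frac_le) auto
          also have "\<dots> = E / gap / t\<^sup>2"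
            by (simp add: power2_eq_square abs_mult_self_eq field_simps)
          also have "\<dots> \<le> C / t\<^sup>2"
            using C by (intro divide_right_mono) auto
          finally show ?thesis .
        qed
        show "norm (z - diag t k) \<le> C / \<bar>t\<bar> \<and>
          (\<exists>v. eigvec t z v \<and> v k = 1 \<and> (\<forall>j<N. j \<noteq> k \<longrightarrow> norm (v j) \<le> C / \<bar>t\<bar> \<and>
            norm (v j - coupling j k / complex_of_real ((c k - c j) * t)) \<le> C / t\<^sup>2))"
          using 1 2 3 v by blast
      qed
    qed
  qed
qed

section \<open>Imaginary parts of eigenvalues\<close>

lemma Im_eigenvalue:
  assumes "eigvec t z v"
  shows "- Im z * (\<Sum>j<N. (norm (v j))\<^sup>2) = \<epsilon> * (norm (v m))\<^sup>2"
proof -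
  \<comment> \<open>The quadratic form of the coupling at v; conjugation amounts to exchanging the
    two summation indices.\<close>
  define q where "q = (\<Sum>j<N. \<Sum>k<N. cnj (v j) * coupling j k * v k)"
  have "cnj q = (\<Sum>j<N. \<Sum>k<N. cnj (v k) * coupling k j * v j)"
    by (simp add: q_def cnj_coupling mult.commute mult.left_commute)
  also have "\<dots> = q"
    unfolding q_def by (rule sum.swap)
  finally have "Im q = 0"
    by (simp add: complex_eq_iff)
  \<comment> \<open>The row equations evaluate the same form diagonally, where the only imaginary
    parts are those of z and of the entry at \<open>m\<close>.\<close>
  moreover have "q = (\<Sum>j<N. (z - diag t j) * of_real ((norm (v j))\<^sup>2))"
    unfolding q_def
  proof (rule sum.cong)
    fix j assume "j \<in> {..<N}"
    then have "(\<Sum>k<N. cnj (v j) * coupling j k * v k) = cnj (v j) * ((z - diag t j) * v j)"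
      using assms by (simp add: eigvec_def sum_distrib_left mult.assoc)
    also have "\<dots> = (z - diag t j) * of_real ((norm (v j))\<^sup>2)"
      by (simp only: complex_norm_square mult_ac)
    finally show "(\<Sum>k<N. cnj (v j) * coupling j k * v k) = (z - diag t j) * of_real ((norm (v j))\<^sup>2)" .
  qed simp
  ultimately have "0 = (\<Sum>j<N. Im (z - diag t j) * (norm (v j))\<^sup>2)"
    by (simp add: Im_sum)
  also have "\<dots> = (\<Sum>j<N. Im z * (norm (v j))\<^sup>2 + (if j = m then \<epsilon> * (norm (v j))\<^sup>2 else 0))"
    by (intro sum.cong) (auto simp: diag_def algebra_simps)
  also have "\<dots> = Im z * (\<Sum>j<N. (norm (v j))\<^sup>2) + \<epsilon> * (norm (v m))\<^sup>2"
    using m_less by (simp add: sum.distrib sum_distrib_left)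
  finally show ?thesis
    by simp
qed

text \<open>The squared moduli differ by a product of a difference, at most \<open>C / t^2\<close>,
  and a sum, at most \<open>3 * C / |t|\<close>. The fourth power arises because the coupling and
  the division each contribute one factor \<open>c j - c k\<close> before squaring.\<close>

lemma norm_square_first_order:
  assumes "C \<ge> 0" "1 \<le> \<bar>t\<bar>" "norm x \<le> C / \<bar>t\<bar>"
    "norm (x - coupling j k / complex_of_real ((c k - c j) * t)) \<le> C / t\<^sup>2"
  shows "\<bar>(norm x)\<^sup>2 - 4 / ((c j - c k) ^ 4 * t\<^sup>2)\<bar> \<le> 3 * C\<^sup>2 / \<bar>t\<bar> ^ 3"
proof -
  let ?y = "coupling j k / complex_of_real ((c k - c j) * t)"
  have norm_y: "norm ?y = 2 / (\<bar>c j - c k\<bar>\<^sup>2 * \<bar>t\<bar>)"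
    by (simp only: power2_eq_square coupling_def norm_divide norm_mult norm_of_real abs_mult abs_minus_commute[of "c k"])
      simp
  have y: "(norm ?y)\<^sup>2 = 4 / ((c j - c k) ^ 4 * t\<^sup>2)"
    unfolding norm_y by (simp add: power_divide power_mult_distrib flip: power_mult)
  \<comment> \<open>The approximation error is also at most \<open>C / |t|\<close>, so the
    approximant is at most \<open>2 * C / |t|\<close>; together with x this gives the 3.\<close>
  have inv: "C / t\<^sup>2 \<le> C / \<bar>t\<bar>"
    using assms(1,2) self_le_power[of "\<bar>t\<bar>" 2] by (intro divide_left_mono) auto
  have "norm ?y \<le> norm x + norm (x - ?y)"
    using norm_triangle_ineq4[of x "x - ?y"] by simp
  then have ny: "norm ?y \<le> 2 * C / \<bar>t\<bar>"
    using assms(3,4) inv by simp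
  have "\<bar>(norm x)\<^sup>2 - (norm ?y)\<^sup>2\<bar> = \<bar>norm x - norm ?y\<bar> * (norm x + norm ?y)"
    by (simp add: power2_eq_square square_diff_square_factored abs_mult mult.commute)
  also have "\<dots> \<le> C / t\<^sup>2 * (3 * C / \<bar>t\<bar>)"
    using assms ny order_trans[OF norm_triangle_ineq3 assms(4)] by (intro mult_mono) auto
  also have "\<dots> = 3 * C\<^sup>2 / \<bar>t\<bar> ^ 3"
    by (simp add: power2_eq_square power3_eq_cube abs_mult_self_eq)
  finally show ?thesis
    by (simp only: y)
qed

text \<open>With \<open>v k = 1\<close> and s the sum of the other squared moduli,
  \<open>- Im z\<close> equals \<epsilon> times the squared modulus of \<open>v m\<close> divided by
  \<open>1 + s\<close>. Since s is of order t^-2, the quotient is needed to first order in s if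
  \<open>k = m\<close>, and to order zero otherwise.\<close>

lemma Im_eigenvalue_asymptotics:
  "\<exists>C. \<forall>\<^sub>F t in at_infinity. \<forall>k<N. \<forall>z\<in>spectrum (M t). norm (z - diag t k) \<le> 1 \<longrightarrow>
     \<bar>- Im z - (if k = m then \<epsilon> - 4 * \<epsilon> * (\<Sum>j\<in>{..<N} - {m}. 1 / ((c j - c m) ^ 4 * t\<^sup>2))
       else 4 * \<epsilon> / ((c k - c m) ^ 4 * t\<^sup>2))\<bar> \<le> C / \<bar>t\<bar> ^ 3"
proof -
  obtain D where D: "D \<ge> 0" and ev: "\<forall>\<^sub>F t in at_infinity. \<forall>k<N. \<forall>z\<in>spectrum (M t).
    norm (z - diag t k) \<le> 1 \<longrightarrow>
     norm (z - diag t k) \<le> D / \<bar>t\<bar> \<and>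
     (\<exists>v. eigvec t z v \<and> v k = 1 \<and> (\<forall>j<N. j \<noteq> k \<longrightarrow> norm (v j) \<le> D / \<bar>t\<bar> \<and>
       norm (v j - coupling j k / complex_of_real ((c k - c j) * t)) \<le> D / t\<^sup>2))"
    using eigvec_first_order by blast
  define B where "B = real N * D\<^sup>2"
  \<comment> \<open>One constant for both cases: \<open>B * B\<close> bounds the s^2 term for
    \<open>k = m\<close>, \<open>B * D^2\<close> the mixed term for \<open>k \<noteq> m\<close>, and
    the last summand covers up to N errors of squared moduli in the first case and a single one in
    the second.\<close>
  define C where "C = \<bar>\<epsilon>\<bar> * (B * B + B * D\<^sup>2 + (real N + 1) * (3 * D\<^sup>2))"
  show ?thesis
  proof (rule exI[of _ C])
    show "\<forall>\<^sub>F t in at_infinity. \<forall>k<N. \<forall>z\<in>spectrum (M t). norm (z - diag t k) \<le> 1 \<longrightarrow>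
     \<bar>- Im z - (if k = m then \<epsilon> - 4 * \<epsilon> * (\<Sum>j\<in>{..<N} - {m}. 1 / ((c j - c m) ^ 4 * t\<^sup>2))
       else 4 * \<epsilon> / ((c k - c m) ^ 4 * t\<^sup>2))\<bar> \<le> C / \<bar>t\<bar> ^ 3"
      using ev eventually_le_abs[of 1]
    proof eventually_elim
      case (elim t)
      show ?case
      proof (intro allI ballI impI)
        fix k z assume k: "k < N" and "z \<in> spectrum (M t)" and "norm (z - diag t k) \<le> 1"
        then obtain v where v: "eigvec t z v" "v k = 1"
          and small: "\<And>j. j < N \<Longrightarrow> j \<noteq> k \<Longrightarrow> norm (v j) \<le> D / \<bar>t\<bar>"
          and first: "\<And>j. j < N \<Longrightarrow> j \<noteq> k \<Longrightarrow>
            norm (v j - coupling j k / complex_of_real ((c k - c j) * t)) \<le> D / t\<^sup>2"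
          using elim(1) by blast
        let ?q = "\<lambda>j. (norm (v j))\<^sup>2" and ?T = "\<bar>t\<bar> ^ 3"
        let ?a = "\<lambda>j k. 4 / ((c j - c k) ^ 4 * t\<^sup>2)"
        have q: "\<bar>?q j - ?a j k\<bar> \<le> 3 * D\<^sup>2 / ?T" if "j < N" "j \<noteq> k" for j
          using that by (intro norm_square_first_order D elim(2) small first)
        have q2: "?q j \<le> D\<^sup>2 / t\<^sup>2" if "j < N" "j \<noteq> k" for j
          using power_mono[OF small[OF that], of 2] by (simp add: power_divide)
        define s where "s = (\<Sum>j\<in>{..<N} - {k}. ?q j)"
        have s: "0 \<le> s" "s \<le> B / t\<^sup>2"
        proof -
          have "s \<le> (\<Sum>j\<in>{..<N} - {k}. D\<^sup>2 / t\<^sup>2)"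
            unfolding s_def by (intro sum_mono q2) auto
          also have "\<dots> \<le> (\<Sum>j<N. D\<^sup>2 / t\<^sup>2)"
            by (intro sum_mono2) auto
          finally show "s \<le> B / t\<^sup>2"
            by (simp add: B_def)
        qed (simp add: s_def sum_nonneg)
        have Im: "- Im z = \<epsilon> * ?q m / (1 + s)"
          using Im_eigenvalue[OF v(1)] v(2) k s(1)
          by (simp add: s_def sum.remove[of "{..<N}" k] eq_divide_eq)
        \<comment> \<open>Products of two terms of order t^-2 are even of order t^-4; |t| >= 1
          weakens this to the common order t^-3.\<close>
        have pow: "x / t\<^sup>2 * (y / t\<^sup>2) \<le> x * y / ?T" if "0 \<le> x" "0 \<le> y" for x y
        proof -
          have "x / t\<^sup>2 * (y / t\<^sup>2) = x * y / \<bar>t\<bar> ^ 4"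
            by (simp add: power2_eq_square power4_eq_xxxx)
          also have "\<dots> \<le> x * y / ?T"
            using that elim(2) power_increasing[of 3 4 "\<bar>t\<bar>"] by (intro divide_left_mono) auto
          finally show ?thesis .
        qed
        have B: "0 \<le> B"
          by (simp add: B_def)
        have le_C: "x \<le> C / ?T"
          if "x \<le> \<bar>\<epsilon>\<bar> * (y / ?T)" "y \<le> B * B + B * D\<^sup>2 + (real N + 1) * (3 * D\<^sup>2)" for x y
        proof -
          have "\<bar>\<epsilon>\<bar> * (y / ?T) \<le> \<bar>\<epsilon>\<bar> * ((B * B + B * D\<^sup>2 + (real N + 1) * (3 * D\<^sup>2)) / ?T)"
            using that(2) by (intro mult_left_mono divide_right_mono) auto
          with that(1) show ?thesis
            by (simp add: C_def)
        qed
        show "\<bar>- Im z - (if k = m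
            then \<epsilon> - 4 * \<epsilon> * (\<Sum>j\<in>{..<N} - {m}. 1 / ((c j - c m) ^ 4 * t\<^sup>2))
            else 4 * \<epsilon> / ((c k - c m) ^ 4 * t\<^sup>2))\<bar> \<le> C / ?T"
        proof (cases "k = m")
          case True
          let ?S = "\<Sum>j\<in>{..<N} - {m}. ?a j m"
          have "\<bar>s - ?S\<bar> \<le> (\<Sum>j\<in>{..<N} - {m}. \<bar>?q j - ?a j m\<bar>)"
            unfolding s_def True sum_subtractf[symmetric] by (rule sum_abs)
          also have "\<dots> \<le> (\<Sum>j\<in>{..<N} - {m}. 3 * D\<^sup>2 / ?T)"
            using q True by (intro sum_mono) auto
          also have "\<dots> \<le> (\<Sum>j<N. 3 * D\<^sup>2 / ?T)"
            by (intro sum_mono2) auto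
          finally have S: "\<bar>s - ?S\<bar> \<le> real N * (3 * D\<^sup>2) / ?T"
            by simp
          \<comment> \<open>This is 1/(1 + s) = 1 - s + s^2/(1 + s).\<close>
          have "- Im z - (\<epsilon> - \<epsilon> * ?S) = \<epsilon> * (s * s / (1 + s) - (s - ?S))"
            unfolding Im True[symmetric] v(2) using s(1) by (simp add: field_simps)
          also have "\<bar>\<dots>\<bar> \<le> \<bar>\<epsilon>\<bar> * (s * s / (1 + s) + \<bar>s - ?S\<bar>)"
            unfolding abs_mult using s(1)
            by (intro mult_left_mono order_trans[OF abs_triangle_ineq4]) auto
          also have "\<dots> \<le> \<bar>\<epsilon>\<bar> * ((B * B + real N * (3 * D\<^sup>2)) / ?T)"
          proof -
            have "s * s / (1 + s) \<le> s * s / 1"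
              using s(1) by (intro divide_left_mono) auto
            also have "\<dots> \<le> B / t\<^sup>2 * (B / t\<^sup>2)"
              using s B by (simp only: div_by_1) (intro mult_mono, auto)
            also have "\<dots> \<le> B * B / ?T"
              using B by (intro pow)
            finally show ?thesis
              using S by (intro mult_left_mono) (auto simp: add_divide_distrib)
          qed
          finally have "\<bar>- Im z - (\<epsilon> - \<epsilon> * ?S)\<bar> \<le> C / ?T"
            by (rule le_C) (use B in \<open>simp add: distrib_right\<close>)
          moreover have "\<epsilon> * ?S = 4 * \<epsilon> * (\<Sum>j\<in>{..<N} - {m}. 1 / ((c j - c m) ^ 4 * t\<^sup>2))"
            by (simp add: sum_distrib_left mult.commute)
          ultimately show ?thesis
            using True by simp
        next
          case False
          \<comment> \<open>Here 1/(1 + s) = 1 - s/(1 + s) is enough, because the numerator is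
            already of order t^-2.\<close>
          have "- Im z - \<epsilon> * ?a m k = \<epsilon> * ((?q m - ?a m k) - ?q m * s / (1 + s))"
            unfolding Im using s(1) by (simp add: divide_simps) (simp add: algebra_simps)
          also have "\<bar>\<dots>\<bar> \<le> \<bar>\<epsilon>\<bar> * (\<bar>?q m - ?a m k\<bar> + ?q m * s / (1 + s))"
            unfolding abs_mult using s(1)
            by (intro mult_left_mono order_trans[OF abs_triangle_ineq4]) auto
          also have "\<dots> \<le> \<bar>\<epsilon>\<bar> * ((3 * D\<^sup>2 + B * D\<^sup>2) / ?T)"
          proof -
            have "?q m * s / (1 + s) \<le> ?q m * s / 1"
              using s(1) by (intro divide_left_mono) auto
            also have "\<dots> \<le> D\<^sup>2 / t\<^sup>2 * (B / t\<^sup>2)"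
              using s B q2[OF m_less] False by (simp only: div_by_1) (intro mult_mono, auto)
            also have "\<dots> \<le> D\<^sup>2 * B / ?T"
              using B by (intro pow) auto
            finally show ?thesis
              using q[OF m_less] False by (intro mult_left_mono) (auto simp: add_divide_distrib mult.commute)
          qed
          finally have "\<bar>- Im z - \<epsilon> * ?a m k\<bar> \<le> C / ?T"
            by (rule le_C) (use B in \<open>simp add: distrib_right\<close>)
          moreover have "(c m - c k) ^ 4 = (c k - c m) ^ 4"
            by (simp add: power4_eq_xxxx algebra_simps)
          ultimately show ?thesis
            using False by (simp add: mult.commute)
        qed
      qed
    qed
  qed
qed

section \<open>Labelled eigenvalue branches\<close>

lemma eigenvalue_branches_iff:
  "eigenvalue_branches F N c \<gamma> m \<epsilon> z \<longleftrightarrow>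
     (\<forall>\<^sub>F t in F. bij_betw (\<lambda>k. z k t) {..<N} (spectrum (M t))) \<and>
     (\<forall>k<N. (\<lambda>t. z k t - diag t k) \<in> O[F](\<lambda>t. complex_of_real (1 / \<bar>t\<bar>)))"
  unfolding eigenvalue_branches_def diag_def ..

text \<open>One eigenvalue is chosen from each disc. The discs are eventually disjoint, so the
  choices are distinct, and N distinct eigenvalues exhaust the spectrum of an N x N matrix.\<close>

lemma eigenvalue_branches_exist:
  assumes F: "F \<le> at_infinity"
  shows "\<exists>z. eigenvalue_branches F N c \<gamma> m \<epsilon> z"
proof -
  let ?P = "\<lambda>t k z. z \<in> spectrum (M t) \<and> norm (z - diag t k) \<le> coupling_bound"
  \<comment> \<open>For small |t| the choice may be arbitrary; the branch conditions hold
    eventually.\<close>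
  define z where "z k t = (SOME z. ?P t k z)" for k t
  have P: "\<forall>\<^sub>F t in at_infinity. \<forall>k<N. ?P t k (z k t)"
    using exists_eigenvalue_near_diag
  proof eventually_elim
    case (elim t)
    then show ?case
      unfolding z_def by (metis (mono_tags, lifting) someI_ex)
  qed
  have "\<forall>\<^sub>F t in at_infinity. bij_betw (\<lambda>k. z k t) {..<N} (spectrum (M t))"
    using P diag_separated eventually_le_abs[of "4 * coupling_bound / gap + 1"]
  proof eventually_elim
    case (elim t)
    have t: "4 * coupling_bound < gap * \<bar>t\<bar>"
    proof -
      have "4 * coupling_bound / gap < \<bar>t\<bar>"
        using elim(3) by simp
      then show ?thesis
        using gap_pos by (simp add: divide_less_eq mult.commute)
    qed
    have inj: "inj_on (\<lambda>k. z k t) {..<N}"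
    proof (rule inj_onI, rule ccontr)
      fix j k assume jk: "j \<in> {..<N}" "k \<in> {..<N}" "z j t = z k t" "j \<noteq> k"
      have "gap / 2 * \<bar>t\<bar> \<le> norm (diag t j - diag t k)"
        using elim(2) jk by blast
      also have "\<dots> \<le> norm (z k t - diag t k) + norm (z j t - diag t j)"
        using norm_triangle_ineq4[of "z k t - diag t k" "z j t - diag t j"] jk(3) by simp
      also have "\<dots> \<le> coupling_bound + coupling_bound"
        using elim(1) jk by (intro add_mono) auto
      finally show False
        using t by simp
    qed
    moreover have "(\<lambda>k. z k t) ` {..<N} = spectrum (M t)"
      using elim(1) card_finite_spectrum[OF M_carrier, of t] card_image[OF inj]
      by (intro card_seteq) auto
    ultimately show ?case
      by (simp add: bij_betw_def)
  qed
  \<comment> \<open>Membership in a disc of fixed radius improves to the rate 1/|t| that the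
    labelling demands.\<close>
  moreover obtain C where C: "\<forall>\<^sub>F t in at_infinity. \<forall>k<N. \<forall>z\<in>spectrum (M t).
      norm (z - diag t k) \<le> coupling_bound \<longrightarrow> norm (z - diag t k) \<le> C / \<bar>t\<bar>"
    using eigvec_first_order[of coupling_bound]
    by (elim exE conjE) (rule that, erule eventually_mono, blast)
  have "(\<lambda>t. z k t - diag t k) \<in> O[at_infinity](\<lambda>t. complex_of_real (1 / \<bar>t\<bar>))" if "k < N" for k
  proof (rule bigoI[where c = C])
    show "\<forall>\<^sub>F t in at_infinity. norm (z k t - diag t k) \<le> C * norm (complex_of_real (1 / \<bar>t\<bar>))"
      using P C
    proof eventually_elim
      case (elim t)
      with that show ?case
        by (auto simp: norm_divide)
    qed
  qed
  ultimately show ?thesis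
    unfolding eigenvalue_branches_iff
    using F by (blast intro: filter_leD landau_o.big.filter_mono)
qed

text \<open>The labelling puts \<open>z k t\<close> within distance 1 of \<open>diag t k\<close>
  once |t| exceeds the constant of its error term; from there the uniform estimate over the spectrum
  applies.\<close>

lemma eigenvalue_branches_Im:
  assumes F: "F \<le> at_infinity" and z: "eigenvalue_branches F N c \<gamma> m \<epsilon> z" and k: "k < N"
  shows "(\<lambda>t. - Im (z k t) -
      (if k = m then \<epsilon> - 4 * \<epsilon> * (\<Sum>j\<in>{..<N} - {m}. 1 / ((c j - c m) ^ 4 * t\<^sup>2))
       else 4 * \<epsilon> / ((c k - c m) ^ 4 * t\<^sup>2))) \<in> O[F](\<lambda>t. 1 / \<bar>t\<bar> ^ 3)"
proof -
  obtain C where C: "\<forall>\<^sub>F t in at_infinity. \<forall>k<N. \<forall>z\<in>spectrum (M t). norm (z - diag t k) \<le> 1 \<longrightarrow>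
     \<bar>- Im z - (if k = m then \<epsilon> - 4 * \<epsilon> * (\<Sum>j\<in>{..<N} - {m}. 1 / ((c j - c m) ^ 4 * t\<^sup>2))
       else 4 * \<epsilon> / ((c k - c m) ^ 4 * t\<^sup>2))\<bar> \<le> C / \<bar>t\<bar> ^ 3"
    using Im_eigenvalue_asymptotics ..
  have bij: "\<forall>\<^sub>F t in F. bij_betw (\<lambda>k. z k t) {..<N} (spectrum (M t))"
    and "(\<lambda>t. z k t - diag t k) \<in> O[F](\<lambda>t. complex_of_real (1 / \<bar>t\<bar>))"
    using z k by (simp_all only: eigenvalue_branches_iff)
  then obtain D where D: "D > 0" "\<forall>\<^sub>F t in F. norm (z k t - diag t k) \<le> D * norm (complex_of_real (1 / \<bar>t\<bar>))"
    by (elim landau_o.bigE)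
  show ?thesis
  proof (rule bigoI[where c = C])
    show "\<forall>\<^sub>F t in F. norm (- Im (z k t) -
      (if k = m then \<epsilon> - 4 * \<epsilon> * (\<Sum>j\<in>{..<N} - {m}. 1 / ((c j - c m) ^ 4 * t\<^sup>2))
       else 4 * \<epsilon> / ((c k - c m) ^ 4 * t\<^sup>2))) \<le> C * norm (1 / \<bar>t\<bar> ^ 3)"
      using filter_leD[OF F C] D(2) bij filter_leD[OF F eventually_le_abs[of "max 1 D"]]
    proof eventually_elim
      case (elim t)
      have "D * norm (complex_of_real (1 / \<bar>t\<bar>)) \<le> 1"
        using elim(4) by (auto simp: norm_divide divide_le_eq_1)
      then have "norm (z k t - diag t k) \<le> 1"
        using elim(2) by linarith
      moreover have "z k t \<in> spectrum (M t)"
        using elim(3) k by (auto simp: bij_betw_def)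
      ultimately show ?case
        using elim(1) k by (simp only: real_norm_def abs_divide power_abs[symmetric]) auto
    qed
  qed
qed

end

theorem proposition4p1:
  fixes N m :: nat and c \<gamma> :: "nat \<Rightarrow> real" and \<epsilon> :: real and F :: "real filter"
  assumes "inj_on c {..<N}"
    and "m < N"
    and "\<epsilon> > 0"
    and "F = at_top \<or> F = at_bot"
  shows "(\<exists>z. eigenvalue_branches F N c \<gamma> m \<epsilon> z) \<and>
    (\<forall>z. eigenvalue_branches F N c \<gamma> m \<epsilon> z \<longrightarrow>
      (\<lambda>t. - Im (z m t) - (\<epsilon> - 4 * \<epsilon> * (\<Sum>k\<in>{..<N} - {m}. 1 / ((c k - c m) ^ 4 * t ^ 2))))
        \<in> O[F](\<lambda>t. 1 / \<bar>t\<bar> ^ 3) \<and>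
      (\<forall>k<N. k \<noteq> m \<longrightarrow>
        (\<lambda>t. - Im (z k t) - 4 * \<epsilon> / ((c k - c m) ^ 4 * t ^ 2)) \<in> O[F](\<lambda>t. 1 / \<bar>t\<bar> ^ 3)))"
proof -
  interpret perturbed_family N m c \<gamma> \<epsilon>
    using assms by unfold_locales
  \<comment> \<open>Both directions refine \<open>at_infinity\<close>, so every estimate in |t|
    passes to either one.\<close>
  have F: "F \<le> at_infinity"
    using assms(4) at_top_le_at_infinity at_bot_le_at_infinity by auto
  show ?thesis
  proof (intro conjI allI impI)
    show "\<exists>z. eigenvalue_branches F N c \<gamma> m \<epsilon> z"
      using eigenvalue_branches_exist[OF F] .
  next
    fix z assume z: "eigenvalue_branches F N c \<gamma> m \<epsilon> z"
    show "(\<lambda>t. - Im (z m t) - (\<epsilon> - 4 * \<epsilon> * (\<Sum>k\<in>{..<N} - {m}. 1 / ((c k - c m) ^ 4 * t ^ 2))))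
        \<in> O[F](\<lambda>t. 1 / \<bar>t\<bar> ^ 3)"
      using eigenvalue_branches_Im[OF F z m_less] by simp
    fix k assume "k < N" "k \<noteq> m"
    then show "(\<lambda>t. - Im (z k t) - 4 * \<epsilon> / ((c k - c m) ^ 4 * t ^ 2)) \<in> O[F](\<lambda>t. 1 / \<bar>t\<bar> ^ 3)"
      using eigenvalue_branches_Im[OF F z, of k] by simp
  qed
qed

end
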